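(* Let $\mathcal{G}=\{G_w : w\in W\}$ be a set-based weighted graph on the complete undirected graph $G=\langle V,E\rangle$. Let $SE\subseteq E$ be the edge set output by the approximate procedure described in the context. Then $SE$ is a subset of the set of strong edges of $G$.
   Context: $G=\langle V,E\rangle$ is a fully connected (complete) undirected graph with finite node set $V$, $m=|V|$, and no loops. $W$ is a non-empty set of weight functions $w:E\to\mathbb{R}$; $G_w$ denotes $G$ with edge weights $w$, and $\mathcal{G}=\{G_w: w\in W\}$ is called a set-based weighted graph. For each $w$, a maximum spanning tree of $G_w$ is a spanning tree maximizing the sum of its edge weights under $w$ (there may be several). $\mathcal{T}$ is the set of all maximum spanning trees of all graphs $G_w$, $w\in W$. An edge is strong if it belongs to every tree in $\mathcal{T}$. Edge $e$ dominates edge $e'$ if $w(e)>w(e')$ for all $w\in W$. Approximate procedure. A subtree is a tree with a number of nodes in $\{2,\dots,m-1\}$; a subtree in $SE$ is a subtree all of whose edges belong to $SE$. 1. Let $SE=\emptyset$. 2. For each $v\in V$: if there is a node $v'\in V$, $v'\ne v$, such that $(v,v')\notin SE$ and $(v,v')$ dominates $(v,v'')$ for each $v''\in V$ with $v''\neq v'$, $v''\ne v$, then add $(v,v')$ to $SE$. 3. If there is a subtree in $SE$, then: (a) make it the current subtree; (b) consider the set $E'\subseteq E$ of edges with one endpoint among the nodes of the current subtree and the other outside; (c) if there is an edge $e'\in E'$ that dominates all the other edges in $E'$, then add $e'$ to $SE$ and to the current subtree, and go to (b); (d) else, if there is another subtree in $SE$ not considered yet, go to (a) with that subtree; else output $SE$.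 If in step 3 there is no subtree in $SE$, output $SE$. *)

theory Defs
  imports Complex_Main
begin

text \<open>
  An edge is its two-element set of endpoints. A graph is given by a node set and a set of edges.
  A weight function is a total function on node sets; only its values on edges are ever used.
\<close>

type_synonym 'a edge = "'a set"
type_synonym 'a weight = "'a edge \<Rightarrow> real"

definition complete_edges :: "'a set \<Rightarrow> 'a edge set" where
  "complete_edges V = {e. e \<subseteq> V \<and> card e = 2}"

definition adjacency :: "'a edge set \<Rightarrow> ('a \<times> 'a) set" where
  "adjacency F = {(u, v). {u, v} \<in> F}"

definition connected_graph :: "'a set \<Rightarrow> 'a edge set \<Rightarrow> bool" where
  "connected_graph N F \<longleftrightarrow> (\<forall>u\<in>N. \<forall>v\<in>N. (u, v) \<in> (adjacency F)\<^sup>*)"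

text \<open>A cycle is the list of its distinct nodes in cyclic order, the first one not repeated.\<close>

definition cycle_in :: "'a edge set \<Rightarrow> 'a list \<Rightarrow> bool" where
  "cycle_in F c \<longleftrightarrow> 3 \<le> length c \<and> distinct c \<and>
     (\<forall>i<length c. {c ! i, c ! (Suc i mod length c)} \<in> F)"

definition tree :: "'a set \<Rightarrow> 'a edge set \<Rightarrow> bool" where
  "tree N F \<longleftrightarrow> F \<subseteq> complete_edges N \<and> connected_graph N F \<and> (\<nexists>c. cycle_in F c)"

definition spanning_tree :: "'a set \<Rightarrow> 'a edge set \<Rightarrow> bool" where
  "spanning_tree V T \<longleftrightarrow> tree V T"

definition max_spanning_tree :: "'a set \<Rightarrow> 'a weight \<Rightarrow> 'a edge set \<Rightarrow> bool" where
  "max_spanning_tree V w T \<longleftrightarrow>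
     spanning_tree V T \<and> (\<forall>T'. spanning_tree V T' \<longrightarrow> (\<Sum>e\<in>T'. w e) \<le> (\<Sum>e\<in>T. w e))"

definition max_spanning_trees :: "'a set \<Rightarrow> 'a weight set \<Rightarrow> 'a edge set set" where
  "max_spanning_trees V W = {T. \<exists>w\<in>W. max_spanning_tree V w T}"

definition strong_edges :: "'a set \<Rightarrow> 'a weight set \<Rightarrow> 'a edge set" where
  "strong_edges V W = {e \<in> complete_edges V. \<forall>T\<in>max_spanning_trees V W. e \<in> T}"

definition dominates :: "'a weight set \<Rightarrow> 'a edge \<Rightarrow> 'a edge \<Rightarrow> bool" where
  "dominates W e e' \<longleftrightarrow> (\<forall>w\<in>W. w e' < w e)"

definition subtree_in :: "'a set \<Rightarrow> 'a edge set \<Rightarrow> 'a set \<Rightarrow> 'a edge set \<Rightarrow> bool" where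
  "subtree_in V SE N F \<longleftrightarrow>
     N \<subseteq> V \<and> F \<subseteq> SE \<and> tree N F \<and> 2 \<le> card N \<and> card N < card V"

definition boundary :: "'a set \<Rightarrow> 'a set \<Rightarrow> 'a edge set" where
  "boundary V N = {{u, v} |u v. u \<in> N \<and> v \<in> V - N}"

definition node_candidate ::
  "'a set \<Rightarrow> 'a weight set \<Rightarrow> 'a edge set \<Rightarrow> 'a \<Rightarrow> 'a \<Rightarrow> bool" where
  "node_candidate V W SE v v' \<longleftrightarrow>
     v' \<in> V \<and> v' \<noteq> v \<and> {v, v'} \<notin> SE \<and>
     (\<forall>v''\<in>V. v'' \<noteq> v' \<and> v'' \<noteq> v \<longrightarrow> dominates W {v, v'} {v, v''})"

definition boundary_candidate :: "'a set \<Rightarrow> 'a weight set \<Rightarrow> 'a set \<Rightarrow> 'a edge \<Rightarrow> bool" where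
  "boundary_candidate V W N e' \<longleftrightarrow>
     e' \<in> boundary V N \<and> (\<forall>e\<in>boundary V N. e \<noteq> e' \<longrightarrow> dominates W e' e)"

text \<open>
  The procedure is a nondeterministic transition system: the order in which nodes are scanned and
  the choice of the next subtree are left open. The last argument of each state is the current
  value of \<open>SE\<close>. In \<open>Scan R SE\<close>, \<open>R\<close> is the set of nodes still to be scanned. In \<open>Select C SE\<close>
  and \<open>Grow C N F SE\<close>, \<open>C\<close> is the set of subtrees considered so far, that is, of those that have
  been the current subtree at some point; \<open>(N, F)\<close> is the current subtree.
\<close>

datatype 'a state =
    Scan "'a set" "'a edge set"
  | Select "('a set \<times> 'a edge set) set" "'a edge set"
  | Grow "('a set \<times> 'a edge set) set" "'a set" "'a edge set" "'a edge set"
  | Output "'a edge set"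

inductive step :: "'a set \<Rightarrow> 'a weight set \<Rightarrow> 'a state \<Rightarrow> 'a state \<Rightarrow> bool"
  for V :: "'a set" and W :: "'a weight set" where
  scan_add: "v \<in> R \<Longrightarrow> node_candidate V W SE v v' \<Longrightarrow>
    step V W (Scan R SE) (Scan (R - {v}) (insert {v, v'} SE))"
| scan_skip: "v \<in> R \<Longrightarrow> (\<nexists>v'. node_candidate V W SE v v') \<Longrightarrow>
    step V W (Scan R SE) (Scan (R - {v}) SE)"
| scan_end: "step V W (Scan {} SE) (Select {} SE)"
| select: "subtree_in V SE N F \<Longrightarrow> (N, F) \<notin> C \<Longrightarrow>
    step V W (Select C SE) (Grow (insert (N, F) C) N F SE)"
| finish: "(\<nexists>N F. subtree_in V SE N F \<and> (N, F) \<notin> C) \<Longrightarrow>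
    step V W (Select C SE) (Output SE)"
| grow: "boundary_candidate V W N e' \<Longrightarrow>
    step V W (Grow C N F SE)
      (Grow (insert (N \<union> e', insert e' F) C) (N \<union> e') (insert e' F) (insert e' SE))"
| stuck: "(\<nexists>e'. boundary_candidate V W N e') \<Longrightarrow>
    step V W (Grow C N F SE) (Select C SE)"

definition approx_output :: "'a set \<Rightarrow> 'a weight set \<Rightarrow> 'a edge set \<Rightarrow> bool" where
  "approx_output V W SE \<longleftrightarrow> (step V W)\<^sup>*\<^sup>* (Scan V {}) (Output SE)"

end

theory Submission
  imports Defs
begin

text \<open>
  Every edge that the procedure adds is the strictly heaviest edge of a cut for every weight
  function: the cut around a single node in the scan, the cut around the current subtree while
  growing. A spanning tree that avoids such an edge \<open>{u, v}\<close> has an edge on its path from \<open>u\<close> to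
  \<open>v\<close> that crosses the same cut; exchanging the two increases the weight. To keep this exchange
  free of path surgery, acyclicity is used in the form ``every edge is a bridge'', and the
  path from \<open>u\<close> to \<open>v\<close> is replaced by a minimal set of edges connecting \<open>u\<close> and \<open>v\<close>.
\<close>

section \<open>Reachability along edges\<close>

abbreviation linked :: "'a edge set \<Rightarrow> 'a \<Rightarrow> 'a \<Rightarrow> bool" where
  "linked F u v \<equiv> (u, v) \<in> (adjacency F)\<^sup>*"

lemma linked_sym: "linked F u v \<Longrightarrow> linked F v u"
  by (rule symD[OF sym_rtrancl]) (auto simp: sym_def adjacency_def insert_commute)

lemma linked_mono: "linked F u v \<Longrightarrow> F \<subseteq> F' \<Longrightarrow> linked F' u v"
  using rtrancl_mono[of "adjacency F" "adjacency F'"] by (auto simp: adjacency_def)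

lemma linked_edge: "{u, v} \<in> F \<Longrightarrow> linked F u v"
  by (auto simp: adjacency_def)

lemma linked_trans: "linked F u v \<Longrightarrow> linked F v x \<Longrightarrow> linked F u x"
  by (rule rtrancl_trans)

text \<open>Repeated traversals of \<open>{u, v}\<close> collapse to at most one: right after a
  traversal the walk stands at \<open>u\<close> or \<open>v\<close>, so the part of it that follows
  is the empty walk. Applied to \<open>F\<close> minus an edge, this describes what deleting that
  edge destroys.\<close>

lemma linked_insert:
  assumes "linked (insert {u, v} F) a b"
  shows "linked F a b \<or> linked F a u \<and> linked F v b \<or> linked F a v \<and> linked F u b"
  using assms
proof (induction rule: rtrancl_induct)
  case base
  then show ?case by simp
next
  case (step y z)
  have "{y, z} \<in> F \<or> y = u \<and> z = v \<or> y = v \<and> z = u"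
    using step.hyps(2) by (auto simp: adjacency_def doubleton_eq_iff)
  then show ?case
  proof (elim disjE)
    assume "{y, z} \<in> F"
    then show ?thesis
      using step.IH linked_trans[OF _ linked_edge[of y z F]] by blast
  qed (use step.IH in blast)+
qed

lemma linked_path:
  assumes "linked F u v"
  obtains p where "p \<noteq> []" "hd p = u" "last p = v" "distinct p"
    "successively (\<lambda>x y. {x, y} \<in> F) p"
proof -
  have "\<exists>p. p \<noteq> [] \<and> hd p = u \<and> last p = v \<and> distinct p \<and> successively (\<lambda>x y. {x, y} \<in> F) p"
    using assms
  proof (induction rule: rtrancl_induct)
    case base
    show ?case by (rule exI[of _ "[u]"]) simp
  next
    case (step y z)
    then obtain p where p: "p \<noteq> []" "hd p = u" "last p = y" "distinct p"
      "successively (\<lambda>x y. {x, y} \<in> F) p" by blast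
    show ?case
    proof (cases "z \<in> set p")
      case True
      \<comment> \<open>The new node already lies on the path, so the path is cut back to its
        occurrence to stay distinct.\<close>
      then obtain q r where "p = q @ z # r" by (auto simp: in_set_conv_decomp)
      then show ?thesis
        using p by (intro exI[of _ "q @ [z]"]) (auto simp: successively_append_iff hd_append)
    next
      case False
      then show ?thesis
        using p step.hyps(2)
        by (intro exI[of _ "p @ [z]"]) (auto simp: successively_append_iff adjacency_def)
    qed
  qed
  then show ?thesis using that by blast
qed

section \<open>Acyclicity as the bridge property\<close>

lemma acyclic_iff_bridges:
  "(\<nexists>c. cycle_in F c) \<longleftrightarrow>
     (\<forall>x y. x \<noteq> y \<longrightarrow> {x, y} \<in> F \<longrightarrow> \<not> linked (F - {{x, y}}) x y)"
proof (intro iffI allI impI notI)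
  fix x y
  assume acyclic: "\<nexists>c. cycle_in F c" and ne: "x \<noteq> y" and xy: "{x, y} \<in> F"
    and "linked (F - {{x, y}}) x y"
  then obtain p where p: "p \<noteq> []" "hd p = x" "last p = y" "distinct p"
    "successively (\<lambda>a b. {a, b} \<in> F - {{x, y}}) p"
    using linked_path by metis
  have ends: "p ! 0 = x" "p ! (length p - 1) = y"
    using p by (simp_all add: hd_conv_nth last_conv_nth)
  have nth: "{p ! i, p ! Suc i} \<in> F - {{x, y}}" if "Suc i < length p" for i
    using p(5) that by (simp add: successively_conv_nth)
  \<comment> \<open>A path with two nodes would be the single edge \<open>{x, y}\<close>, which has
    been deleted; hence \<open>p\<close> is long enough to be closed into a cycle.\<close>
  have "length p \<noteq> 1" using ends ne by auto
  moreover have "length p \<noteq> 2" using nth[of 0] ends by auto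
  ultimately have len: "3 \<le> length p" using p(1) by (cases "length p") auto
  have "{p ! i, p ! (Suc i mod length p)} \<in> F" if "i < length p" for i
  proof (cases "Suc i < length p")
    case True
    then show ?thesis using nth[of i] by simp
  next
    case False
    then have "Suc i = length p" using that by simp
    \<comment> \<open>The last index wraps around to 0, which gives the deleted edge
      \<open>{x, y}\<close>.\<close>
    then show ?thesis using ends xy by (metis diff_Suc_1 insert_commute mod_self)
  qed
  then have "cycle_in F p" using len p(4) by (simp add: cycle_in_def)
  then show False using acyclic by blast
next
  assume bridges: "\<forall>x y. x \<noteq> y \<longrightarrow> {x, y} \<in> F \<longrightarrow> \<not> linked (F - {{x, y}}) x y"
    and "\<exists>c. cycle_in F c"
  then obtain c where c: "3 \<le> length c" "distinct c"
    and edge: "\<And>i. i < length c \<Longrightarrow> {c ! i, c ! (Suc i mod length c)} \<in> F"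
    by (auto simp: cycle_in_def)
  \<comment> \<open>The edge refuting the bridge property is the closing edge
    \<open>{c ! 0, c ! n}\<close>; the rest of the cycle still links its ends.\<close>
  define n where "n = length c - 1"
  have n: "length c = Suc n" "2 \<le> n" using c(1) by (auto simp: n_def)
  have eq_iff: "c ! i = c ! j \<longleftrightarrow> i = j" if "i \<le> n" "j \<le> n" for i j
    using that c(2) n(1) by (simp add: nth_eq_iff_index_eq)
  have "linked (F - {{c ! 0, c ! n}}) (c ! 0) (c ! i)" if "i \<le> n" for i
    using that
  proof (induction i)
    case 0
    then show ?case by simp
  next
    case (Suc i)
    have "{c ! i, c ! Suc i} \<in> F" using edge[of i] Suc.prems n by simp
    \<comment> \<open>Equality would force \<open>i = 0\<close> and \<open>n = 1\<close>, but a
      cycle has \<open>n\<close> at least 2.\<close>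
    moreover have "{c ! i, c ! Suc i} \<noteq> {c ! 0, c ! n}"
      using Suc.prems n(2) by (auto simp: doubleton_eq_iff eq_iff)
    ultimately show ?case
      using linked_trans[OF Suc.IH linked_edge] Suc.prems by auto
  qed
  then have "linked (F - {{c ! 0, c ! n}}) (c ! 0) (c ! n)" by simp
  moreover have "c ! 0 \<noteq> c ! n" using n(2) by (simp add: eq_iff)
  moreover have "{c ! 0, c ! n} \<in> F" using edge[of n] n(1) by (simp add: insert_commute)
  ultimately show False using bridges by blast
qed

lemma tree_iff_bridges:
  "tree N F \<longleftrightarrow> F \<subseteq> complete_edges N \<and> connected_graph N F \<and>
     (\<forall>x y. x \<noteq> y \<longrightarrow> {x, y} \<in> F \<longrightarrow> \<not> linked (F - {{x, y}}) x y)"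
  unfolding tree_def acyclic_iff_bridges ..

lemma tree_bridge:
  "tree N F \<Longrightarrow> x \<noteq> y \<Longrightarrow> {x, y} \<in> F \<Longrightarrow> \<not> linked (F - {{x, y}}) x y"
  by (simp add: tree_iff_bridges)

section \<open>Exchanging edges across a cut\<close>

lemma linked_crosses_cut:
  assumes "linked F u v" and "u \<in> N" and "v \<notin> N"
  obtains x y where "{x, y} \<in> F" "x \<in> N" "y \<notin> N"
proof -
  have "\<exists>x y. {x, y} \<in> F \<and> x \<in> N \<and> y \<notin> N"
    using assms(1,3)
  proof (induction rule: rtrancl_induct)
    case base
    then show ?case using assms(2) by simp
  next
    case (step y z)
    then show ?case by (cases "y \<in> N") (auto simp: adjacency_def)
  qed
  then show ?thesis using that by blast
qed

text \<open>A crossing edge of \<open>T\<close> need not separate \<open>u\<close> from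
  \<open>v\<close>, but one taken from an inclusion-minimal subset \<open>P\<close> linking them
  does. The rest of \<open>P\<close> joins one of its ends to \<open>u\<close> and the other to
  \<open>v\<close>, so a link from \<open>u\<close> to \<open>v\<close> in \<open>T\<close> avoiding
  it would also link its ends, although every edge of a tree is a bridge.\<close>

lemma tree_separating_edge:
  assumes "tree V T" and "finite T" and "linked T u v" and "u \<in> N" and "v \<notin> N"
  obtains x y where "{x, y} \<in> T" "x \<in> N" "y \<notin> N" "\<not> linked (T - {{x, y}}) u v"
proof -
  define Ps where "Ps = {P. P \<subseteq> T \<and> linked P u v}"
  have "finite Ps" "T \<in> Ps" using assms(2,3) by (auto simp: Ps_def)
  then obtain P where "P \<in> Ps" and min: "\<And>Q. Q \<in> Ps \<Longrightarrow> Q \<subseteq> P \<Longrightarrow> P = Q"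
    using finite_has_minimal2[of Ps T] by blast
  then have P: "P \<subseteq> T" "linked P u v" by (simp_all add: Ps_def)
  obtain x y where xy: "{x, y} \<in> P" "x \<in> N" "y \<notin> N"
    by (rule linked_crosses_cut[OF P(2) assms(4,5)])
  let ?f = "{x, y}"
  have "P - {?f} \<notin> Ps" using min[of "P - {?f}"] xy(1) by auto
  then have "\<not> linked (P - {?f}) u v" using P(1) by (auto simp: Ps_def)
  moreover have "linked (insert ?f (P - {?f})) u v"
    using P(2) xy(1) by (simp add: insert_absorb)
  ultimately have "linked (P - {?f}) u x \<and> linked (P - {?f}) y v \<or>
      linked (P - {?f}) u y \<and> linked (P - {?f}) x v"
    using linked_insert[of u v x y "P - {?f}"] by metis
  then have sides: "linked (T - {?f}) u x \<and> linked (T - {?f}) y v \<or>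
      linked (T - {?f}) u y \<and> linked (T - {?f}) x v"
    using linked_mono[of _ _ "P - {?f}" "T - {?f}"] Diff_mono[OF P(1) order_refl] by metis
  have "\<not> linked (T - {?f}) x y"
    by (rule tree_bridge[OF assms(1)]) (use P(1) xy in auto)
  then have "\<not> linked (T - {?f}) u v"
    using sides linked_trans[of x u "T - {?f}" v] linked_trans[of x v "T - {?f}" y]
      linked_trans[of x v "T - {?f}" u] linked_trans[of x u "T - {?f}" y]
      linked_sym[of u x "T - {?f}"] linked_sym[of y v "T - {?f}"]
      linked_sym[of u y "T - {?f}"] linked_sym[of u v "T - {?f}"]
    by metis
  then show ?thesis using that[of x y] xy P(1) by auto
qed

text \<open>Deleting \<open>f\<close> splits the tree into two sides, with \<open>u\<close> and
  \<open>v\<close> on different ones, and the new edge rejoins them without closing a cycle.\<close>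

lemma tree_exchange:
  assumes T: "tree V T" and f: "f \<in> T" and uv: "u \<in> V" "v \<in> V"
    and sep: "\<not> linked (T - {f}) u v"
  shows "tree V (insert {u, v} (T - {f}))"
proof -
  let ?S = "T - {f}" and ?T' = "insert {u, v} (T - {f})"
  have sub: "T \<subseteq> complete_edges V"
    and conn: "\<And>a b. a \<in> V \<Longrightarrow> b \<in> V \<Longrightarrow> linked T a b"
    using T by (auto simp: tree_iff_bridges connected_graph_def)
  have "u \<noteq> v" using sep by auto
  obtain x y where xy: "f = {x, y}"
    using f sub by (auto simp: complete_edges_def card_2_iff)
  \<comment> \<open>Putting \<open>f\<close> back links \<open>u\<close> and \<open>v\<close>, so
    the ends of \<open>f\<close> lie on the two sides as well; a detour through
    \<open>{u, v}\<close> then replaces \<open>f\<close>.\<close>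
  have "linked (insert {x, y} ?S) u v"
    using conn[OF uv] f xy by (simp add: insert_absorb)
  then have "linked ?S u x \<and> linked ?S y v \<or> linked ?S u y \<and> linked ?S x v"
    using linked_insert[of u v x y ?S] sep by metis
  moreover have "linked ?T' a b" if "linked ?S a b" for a b
    by (rule linked_mono[OF that]) blast
  moreover have "linked ?T' u v" by (rule linked_edge) simp
  ultimately have xy_linked: "linked ?T' x y"
    using linked_sym[of u x ?T'] linked_sym[of y v ?T'] linked_sym[of u y ?T']
      linked_sym[of u v ?T'] linked_trans[of x u ?T' v] linked_trans[of x v ?T' y]
      linked_trans[of x v ?T' u] linked_trans[of x u ?T' y]
    by metis
  have "linked ?T' a b" if "{a, b} \<in> T" for a b
  proof (cases "{a, b} = f")
    case True
    then show ?thesis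
      using xy xy_linked linked_sym[OF xy_linked] by (auto simp: doubleton_eq_iff)
  next
    case False
    then show ?thesis using that by (intro linked_edge) simp
  qed
  then have "adjacency T \<subseteq> (adjacency ?T')\<^sup>*" by (auto simp: adjacency_def)
  then have "linked ?T' a b" if "linked T a b" for a b
    using rtrancl_subset_rtrancl that by blast
  then have "connected_graph V ?T'"
    using conn by (simp add: connected_graph_def)
  moreover have "?T' \<subseteq> complete_edges V"
    using sub uv \<open>u \<noteq> v\<close> by (auto simp: complete_edges_def)
  moreover have "\<not> linked (?T' - {{a, b}}) a b" if "a \<noteq> b" "{a, b} \<in> ?T'" for a b
  proof
    assume linked: "linked (?T' - {{a, b}}) a b"
    show False
    proof (cases "{a, b} = {u, v}")
      case True
      \<comment> \<open>The new edge is a bridge: without it only edges of \<open>?S\<close> remain,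
        and these do not link \<open>u\<close> and \<open>v\<close>.\<close>
      have "linked ?S a b" by (rule linked_mono[OF linked]) (use True in blast)
      then show False
        using True sep linked_sym[of a b ?S] by (metis doubleton_eq_iff)
    next
      case False
      then have ab: "{a, b} \<in> ?S" using that(2) by simp
      let ?R = "?S - {{a, b}}"
      \<comment> \<open>An old edge \<open>{a, b}\<close> is a bridge of \<open>T\<close>, so a link
        around it has to use \<open>{u, v}\<close>. The remaining pieces of that link, joined by
        \<open>{a, b}\<close> itself, would link \<open>u\<close> and \<open>v\<close> in
        \<open>?S\<close>.\<close>
      have "linked (insert {u, v} ?R) a b" by (rule linked_mono[OF linked]) blast
      moreover have "\<not> linked (T - {{a, b}}) a b"
        by (rule tree_bridge[OF T that(1)]) (use ab in simp)
      then have "\<not> linked ?R a b" using linked_mono[of a b ?R]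
        by (metis Diff_mono Diff_subset order_refl)
      ultimately have "linked ?R a u \<and> linked ?R v b \<or> linked ?R a v \<and> linked ?R u b"
        using linked_insert[of a b u v ?R] by metis
      then have "linked ?S a u \<and> linked ?S v b \<or> linked ?S a v \<and> linked ?S u b"
        using linked_mono[of _ _ ?R ?S] Diff_subset by metis
      then show False
        using linked_edge[OF ab] sep linked_sym[of a u ?S] linked_sym[of v b ?S]
          linked_sym[of a v ?S] linked_sym[of a b ?S] linked_trans[of u a ?S b]
          linked_trans[of u b ?S v] linked_trans[of u b ?S a] linked_trans[of u a ?S v]
        by metis
    qed
  qed
  ultimately show ?thesis by (simp add: tree_iff_bridges)
qed

section \<open>Heaviest cut edges are strong\<close>

lemma max_spanning_tree_contains_cut_maximum:
  assumes "finite V" and "N \<subseteq> V" and T: "max_spanning_tree V w T"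
    and e: "e \<in> boundary V N"
    and heaviest: "\<And>f. f \<in> boundary V N \<Longrightarrow> f \<noteq> e \<Longrightarrow> w f < w e"
  shows "e \<in> T"
proof (rule ccontr)
  assume "e \<notin> T"
  have tree: "tree V T"
    and max: "\<And>T'. tree V T' \<Longrightarrow> sum w T' \<le> sum w T"
    using T by (auto simp: max_spanning_tree_def spanning_tree_def)
  have sub: "T \<subseteq> Pow V" using tree by (auto simp: tree_def complete_edges_def)
  then have "finite T" using \<open>finite V\<close> finite_subset by blast
  obtain u v where uv: "e = {u, v}" "u \<in> N" "v \<in> V" "v \<notin> N"
    using e by (auto simp: boundary_def)
  have "u \<in> V" using uv(2) \<open>N \<subseteq> V\<close> by blast
  have linked: "linked T u v"
    using tree \<open>u \<in> V\<close> uv(3) by (simp add: tree_def connected_graph_def)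
  obtain x y where xy: "{x, y} \<in> T" "x \<in> N" "y \<notin> N"
    and sep: "\<not> linked (T - {{x, y}}) u v"
    by (rule tree_separating_edge[OF tree \<open>finite T\<close> linked uv(2,4)])
  have "sum w (insert e (T - {{x, y}})) \<le> sum w T"
    using max tree_exchange[OF tree xy(1) \<open>u \<in> V\<close> uv(3) sep] uv(1) by simp
  moreover have "sum w (insert e (T - {{x, y}})) = w e + (sum w T - w {x, y})"
    using \<open>finite T\<close> \<open>e \<notin> T\<close> xy(1) by (simp add: sum_diff1)
  \<comment> \<open>The removed edge lies in the same cut and differs from \<open>e\<close>, as
    \<open>e\<close> is outside \<open>T\<close>; the exchange thus gains weight strictly, against
    maximality.\<close>
  moreover have "{x, y} \<in> boundary V N" using xy sub by (auto simp: boundary_def)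
  then have "w {x, y} < w e" using heaviest xy(1) \<open>e \<notin> T\<close> by blast
  ultimately show False by simp
qed

lemma boundary_candidate_strong:
  assumes "finite V" and "N \<subseteq> V" and cand: "boundary_candidate V W N e"
  shows "e \<in> strong_edges V W"
proof -
  have e: "e \<in> boundary V N"
    and dom: "\<And>w f. w \<in> W \<Longrightarrow> f \<in> boundary V N \<Longrightarrow> f \<noteq> e \<Longrightarrow> w f < w e"
    using cand by (auto simp: boundary_candidate_def dominates_def)
  have "e \<in> complete_edges V"
    using e \<open>N \<subseteq> V\<close> by (auto simp: boundary_def complete_edges_def card_2_iff)
  moreover have "e \<in> T" if "w \<in> W" "max_spanning_tree V w T" for w T
    using max_spanning_tree_contains_cut_maximum[OF assms(1,2) that(2) e] dom that(1) by blast
  ultimately show ?thesis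
    by (auto simp: strong_edges_def max_spanning_trees_def)
qed

text \<open>The edges at \<open>v\<close> form the cut around \<open>{v}\<close>, so the scan is
  covered by the same cut argument as the growing phase.\<close>

lemma node_candidate_boundary_candidate:
  "node_candidate V W SE v v' \<Longrightarrow> boundary_candidate V W {v} {v, v'}"
  by (auto simp: node_candidate_def boundary_candidate_def boundary_def)

section \<open>The invariant of the procedure\<close>

fun sound :: "'a set \<Rightarrow> 'a weight set \<Rightarrow> 'a state \<Rightarrow> bool" where
  "sound V W (Scan R SE) \<longleftrightarrow> R \<subseteq> V \<and> SE \<subseteq> strong_edges V W"
| "sound V W (Select C SE) \<longleftrightarrow> SE \<subseteq> strong_edges V W"
| "sound V W (Grow C N F SE) \<longleftrightarrow> N \<subseteq> V \<and> SE \<subseteq> strong_edges V W"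
| "sound V W (Output SE) \<longleftrightarrow> SE \<subseteq> strong_edges V W"

text \<open>Strength depends on \<open>V\<close> and \<open>W\<close> alone, so edges added earlier
  stay strong and only the new edge needs an argument. The inclusions in \<open>V\<close> ensure
  that the next cut is taken around a subset of \<open>V\<close>.\<close>

lemma step_sound:
  assumes "finite V" and "step V W s t" and "sound V W s"
  shows "sound V W t"
  using assms(2,3)
proof (induction rule: step.induct)
  case (scan_add v R SE v')
  then have "{v, v'} \<in> strong_edges V W"
    by (intro boundary_candidate_strong[OF \<open>finite V\<close>, of "{v}"]
        node_candidate_boundary_candidate) auto
  then show ?case using scan_add.prems by auto
next
  case (select SE N F C)
  then show ?case by (simp add: subtree_in_def)
next
  case (grow N e' C F SE)
  then have "e' \<in> strong_edges V W"
    by (intro boundary_candidate_strong[OF \<open>finite V\<close>]) auto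
  \<comment> \<open>This keeps the enlarged node set \<open>N \<union> e'\<close> inside
    \<open>V\<close>.\<close>
  moreover from this have "e' \<subseteq> V" by (simp add: strong_edges_def complete_edges_def)
  ultimately show ?case using grow.prems by simp
qed auto

theorem proposition3:
  fixes V :: "'a set" and W :: "'a weight set" and SE :: "'a edge set"
  assumes "finite V"
    and "W \<noteq> {}"
    and "approx_output V W SE"
  shows "SE \<subseteq> strong_edges V W"
proof -
  have "sound V W t" if "(step V W)\<^sup>*\<^sup>* (Scan V {}) t" for t
    using that by (induction rule: rtranclp_induct) (auto intro: step_sound[OF assms(1)])
  then have "sound V W (Output SE)"
    using assms(3) unfolding approx_output_def .
  then show ?thesis by simp
qed

end
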